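(* Let $x^*\in\mathcal{X}^n$, $v\in\mathbb{C}^m$, $r=Hx^*+v$, and let $t^*\in\mathbb{R}^{nM}$ be the vector corresponding to $x^*$. If $$\lambda_{\min}(H^\dagger H)\sin\left(\frac{\pi}{M}\right)>\|H^\dagger v\|_\infty,$$ then $t^*$ is the unique global minimizer of the problem (SQP2) $$\min_{t\in\mathbb{R}^{nM}} f(t)\quad\text{s.t. } \boldsymbol{e}^\top\bar t_j=1,\ j=1,\ldots,n,\quad t\geqslant 0,\quad \|t\|_0\leqslant n,$$ where $f(t)=t^\top\widetilde Gt+2w^\top t$.
   Context: $m,n\geqslant1$ and $M\geqslant 2$ are integers, $H\in\mathbb{C}^{m\times n}$; $(\cdot)^\dagger$ is the conjugate transpose; $\lambda_{\min}$ is the smallest eigenvalue of a Hermitian matrix; $\|\cdot\|_\infty$ is the $\ell_\infty$-norm (maximum modulus of the entries). $\theta_k=2(k-1)\pi/M$ for $k=1,\ldots,M$, and $\mathcal{X}=\{\exp(\mathrm{i}\theta_k): k=1,\ldots,M\}$. $Q=H^\dagger H$, $c=-H^\dagger r$. $\widehat Q=\begin{bmatrix}\mathrm{Re}(Q)&-\mathrm{Im}(Q)\\ \mathrm{Im}(Q)&\mathrm{Re}(Q)\end{bmatrix}\in\mathbb{R}^{2n\times 2n}$, $\hat c=\begin{bmatrix}\mathrm{Re}(c)\\ \mathrm{Im}(c)\end{bmatrix}\in\mathbb{R}^{2n}$. $\alpha=(\cos\theta_1,\ldots,\cos\theta_M)^\top$, $\beta=(\sin\theta_1,\ldots,\sin\theta_M)^\top\in\mathbb{R}^M$.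 $A=I\otimes\alpha^\top$, $B=I\otimes\beta^\top\in\mathbb{R}^{n\times nM}$ ($I$ the $n\times n$ identity, $\otimes$ the Kronecker product), $P=\begin{bmatrix}A\\ B\end{bmatrix}\in\mathbb{R}^{2n\times nM}$, $G=P^\top\widehat QP\in\mathbb{R}^{nM\times nM}$, $w=P^\top\hat c\in\mathbb{R}^{nM}$. $G$ is partitioned into $n\times n$ blocks $S_{jk}\in\mathbb{R}^{M\times M}$; $\widetilde D=\mathrm{Diag}(S_{11},\ldots,S_{nn})$ is the block-diagonal matrix of the diagonal blocks, and $\widetilde G=G-\widetilde D$. A vector $t\in\mathbb{R}^{nM}$ is partitioned as $t=(\bar t_1^\top,\ldots,\bar t_n^\top)^\top$ with blocks $\bar t_j\in\mathbb{R}^M$. $\boldsymbol{e}$ is the all-ones vector, $\|t\|_0$ is the number of nonzero entries of $t$, and $t\geqslant0$ is entrywise. For $x\in\mathcal{X}^n$, the vector $t\in\{0,1\}^{nM}$ corresponding to $x$ is the assignment vector with $(\bar t_j)_k=1$ if $x_j=\exp(\mathrm{i}\theta_k)$ and $(\bar t_j)_k=0$ otherwise; it satisfies $\begin{bmatrix}\mathrm{Re}(x)\\ \mathrm{Im}(x)\end{bmatrix}=Pt$. *)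

theory Defs
  imports
    "Jordan_Normal_Form.Schur_Decomposition"
    "Jordan_Normal_Form.Spectral_Radius"
begin

text \<open>Vectors and matrices are those of Jordan_Normal_Form, so entries and blocks are numbered
  from 0. Only the phases keep the numbering k = 1, ..., M; entry k of a length-M block
  belongs to the phase with number k + 1, and entry k of block j of a vector of length n * M is
  the entry j * M + k of the whole vector.\<close>

definition phase :: "nat \<Rightarrow> nat \<Rightarrow> real" where
  "phase M k = 2 * (real k - 1) * pi / real M"

definition psk_point :: "nat \<Rightarrow> nat \<Rightarrow> complex" where
  "psk_point M k = exp (\<i> * complex_of_real (phase M k))"

definition psk :: "nat \<Rightarrow> complex set" where
  "psk M = psk_point M ` {1..M}"

definition psk_vecs :: "nat \<Rightarrow> nat \<Rightarrow> complex vec set" where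
  "psk_vecs n M = {x \<in> carrier_vec n. \<forall>j<n. x $ j \<in> psk M}"

definition assignment_vec :: "nat \<Rightarrow> nat \<Rightarrow> complex vec \<Rightarrow> real vec" where
  "assignment_vec n M x =
     vec (n * M) (\<lambda>i. if x $ (i div M) = psk_point M (i mod M + 1) then 1 else 0)"

text \<open>Meant for Hermitian matrices of positive dimension: all their eigenvalues are real, and
  there are finitely many but at least one of them. For other matrices only real eigenvalues
  are considered.\<close>

definition lambda_min :: "complex mat \<Rightarrow> real" where
  "lambda_min A = Min {l. eigenvalue A (complex_of_real l)}"

text \<open>Meant for vectors of positive dimension.\<close>

definition linf_norm :: "complex vec \<Rightarrow> real" where
  "linf_norm u = Max {cmod (u $ i) | i. i < dim_vec u}"

definition l0_norm :: "real vec \<Rightarrow> nat" where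
  "l0_norm t = card {i. i < dim_vec t \<and> t $ i \<noteq> 0}"

definition ones_vec :: "nat \<Rightarrow> real vec" where
  "ones_vec d = vec d (\<lambda>_. 1)"

definition block_vec :: "nat \<Rightarrow> real vec \<Rightarrow> nat \<Rightarrow> real vec" where
  "block_vec M t j = vec M (\<lambda>k. t $ (j * M + k))"

definition block_mat :: "nat \<Rightarrow> real mat \<Rightarrow> nat \<Rightarrow> nat \<Rightarrow> real mat" where
  "block_mat M G j k = mat M M (\<lambda>(a, b). G $$ (j * M + a, k * M + b))"

definition kronecker :: "real mat \<Rightarrow> real mat \<Rightarrow> real mat" (infixl "\<otimes>\<^sub>K" 70) where
  "A \<otimes>\<^sub>K B = mat (dim_row A * dim_row B) (dim_col A * dim_col B)
     (\<lambda>(i, j). A $$ (i div dim_row B, j div dim_col B) * B $$ (i mod dim_row B, j mod dim_col B))"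

definition realify_mat :: "complex mat \<Rightarrow> real mat" where
  "realify_mat Q =
     four_block_mat (map_mat Re Q) (- map_mat Im Q)
                    (map_mat Im Q) (map_mat Re Q)"

definition realify_vec :: "complex vec \<Rightarrow> real vec" where
  "realify_vec c = map_vec Re c @\<^sub>v map_vec Im c"

definition Q_mat :: "complex mat \<Rightarrow> complex mat" where
  "Q_mat H = mat_adjoint H * H"

definition c_vec :: "complex mat \<Rightarrow> complex vec \<Rightarrow> complex vec" where
  "c_vec H r = - (mat_adjoint H *\<^sub>v r)"

definition alpha_vec :: "nat \<Rightarrow> real vec" where
  "alpha_vec M = vec M (\<lambda>k. cos (phase M (k + 1)))"

definition beta_vec :: "nat \<Rightarrow> real vec" where
  "beta_vec M = vec M (\<lambda>k. sin (phase M (k + 1)))"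

definition P_mat :: "nat \<Rightarrow> nat \<Rightarrow> real mat" where
  "P_mat n M =
     (1\<^sub>m n \<otimes>\<^sub>K mat_of_row (alpha_vec M)) @\<^sub>r (1\<^sub>m n \<otimes>\<^sub>K mat_of_row (beta_vec M))"

definition G_mat :: "nat \<Rightarrow> nat \<Rightarrow> complex mat \<Rightarrow> real mat" where
  "G_mat n M H = transpose_mat (P_mat n M) * realify_mat (Q_mat H) * P_mat n M"

definition w_vec :: "nat \<Rightarrow> nat \<Rightarrow> complex mat \<Rightarrow> complex vec \<Rightarrow> real vec" where
  "w_vec n M H r = transpose_mat (P_mat n M) *\<^sub>v realify_vec (c_vec H r)"

definition D_tilde :: "nat \<Rightarrow> nat \<Rightarrow> complex mat \<Rightarrow> real mat" where
  "D_tilde n M H = diag_block_mat (map (\<lambda>j. block_mat M (G_mat n M H) j j) [0..<n])"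

definition G_tilde :: "nat \<Rightarrow> nat \<Rightarrow> complex mat \<Rightarrow> real mat" where
  "G_tilde n M H = G_mat n M H - D_tilde n M H"

definition sqp2_objective ::
    "nat \<Rightarrow> nat \<Rightarrow> complex mat \<Rightarrow> complex vec \<Rightarrow> real vec \<Rightarrow> real" where
  "sqp2_objective n M H r t = t \<bullet> (G_tilde n M H *\<^sub>v t) + 2 * (w_vec n M H r \<bullet> t)"

definition sqp2_feasible :: "nat \<Rightarrow> nat \<Rightarrow> real vec \<Rightarrow> bool" where
  "sqp2_feasible n M t \<longleftrightarrow>
     t \<in> carrier_vec (n * M) \<and>
     (\<forall>j<n. ones_vec M \<bullet> block_vec M t j = 1) \<and>
     0\<^sub>v (n * M) \<le> t \<and>
     l0_norm t \<le> n"

end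

theory Submission
  imports Defs
begin

text \<open>A feasible point has exactly one entry 1 in each block, so it is the assignment vector of some
  \<open>x \<in> \<X>\<^sup>n\<close>. On such points \<open>f\<close> equals \<open>\<parallel>H x - r\<parallel>\<^sup>2\<close> up to a constant. With \<open>d = x - x\<^sup>*\<close> the
  objective therefore grows by \<open>\<parallel>H d\<parallel>\<^sup>2 - 2 Re \<langle>d, H\<^sup>\<dagger> v\<rangle>\<close>. Since \<open>\<parallel>H d\<parallel>\<^sup>2 \<ge> \<lambda>\<^sub>m\<^sub>i\<^sub>n \<parallel>d\<parallel>\<^sup>2\<close>
  and each nonzero \<open>d\<^sub>i\<close> has modulus at least \<open>2 sin (\<pi>/M)\<close>, this is at least
  \<open>2 (\<lambda>\<^sub>m\<^sub>i\<^sub>n sin (\<pi>/M) - \<parallel>H\<^sup>\<dagger> v\<parallel>\<^sub>\<infinity>) \<parallel>d\<parallel>\<^sub>1\<close>, which is positive for \<open>d \<noteq> 0\<close>.\<close>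

section \<open>The Rayleigh bound for the smallest eigenvalue\<close>

text \<open>The Euclidean inner product of the stacked real and imaginary parts. It is symmetric and
  real bilinear, and it suffices because only real values of quadratic and linear forms are
  compared.\<close>

definition re_inner :: "complex vec \<Rightarrow> complex vec \<Rightarrow> real" where
  "re_inner u w = Re (u \<bullet>c w)"

lemma re_inner_eq_sum:
  "u \<in> carrier_vec n \<Longrightarrow> w \<in> carrier_vec n \<Longrightarrow> re_inner u w = (\<Sum>i<n. Re (u $ i * cnj (w $ i)))"
  by (simp add: re_inner_def scalar_prod_def atLeast0LessThan)

lemma re_inner_comm:
  "u \<in> carrier_vec n \<Longrightarrow> w \<in> carrier_vec n \<Longrightarrow> re_inner u w = re_inner w u"
  by (simp add: re_inner_eq_sum[of _ n] mult.commute)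

lemma re_inner_add_left:
  "u \<in> carrier_vec n \<Longrightarrow> v \<in> carrier_vec n \<Longrightarrow> w \<in> carrier_vec n \<Longrightarrow>
   re_inner (u + v) w = re_inner u w + re_inner v w"
  by (simp add: re_inner_eq_sum[of _ n] algebra_simps sum.distrib sum_subtractf)

lemma re_inner_add_right:
  "u \<in> carrier_vec n \<Longrightarrow> v \<in> carrier_vec n \<Longrightarrow> w \<in> carrier_vec n \<Longrightarrow>
   re_inner w (u + v) = re_inner w u + re_inner w v"
  by (simp add: re_inner_eq_sum[of _ n] algebra_simps sum.distrib sum_subtractf)

lemma re_inner_smult_left:
  "u \<in> carrier_vec n \<Longrightarrow> w \<in> carrier_vec n \<Longrightarrow>
   re_inner (complex_of_real a \<cdot>\<^sub>v u) w = a * re_inner u w"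
  by (simp add: re_inner_eq_sum[of _ n] sum_distrib_left algebra_simps)

lemma re_inner_smult_right:
  "u \<in> carrier_vec n \<Longrightarrow> w \<in> carrier_vec n \<Longrightarrow>
   re_inner w (complex_of_real a \<cdot>\<^sub>v u) = a * re_inner w u"
  by (simp add: re_inner_eq_sum[of _ n] sum_distrib_left algebra_simps)

lemma re_inner_uminus_left:
  "u \<in> carrier_vec n \<Longrightarrow> w \<in> carrier_vec n \<Longrightarrow> re_inner (- u) w = - re_inner u w"
  by (simp add: re_inner_eq_sum[of _ n] sum.distrib sum_subtractf sum_negf)

lemma re_inner_self: "x \<in> carrier_vec n \<Longrightarrow> re_inner x x = (\<Sum>i<n. (cmod (x $ i))\<^sup>2)"
  by (simp add: re_inner_eq_sum[of _ n] cmod_power2 flip: power2_eq_square)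

lemma re_inner_self_nonneg: "x \<in> carrier_vec n \<Longrightarrow> 0 \<le> re_inner x x"
  by (simp add: re_inner_self sum_nonneg)

section \<open>Bounds on complex matrices and their quadratic forms\<close>

lemma index_mult_mat_vec_sum:
  "A \<in> carrier_mat m n \<Longrightarrow> x \<in> carrier_vec n \<Longrightarrow> i < m \<Longrightarrow>
   (A *\<^sub>v x) $ i = (\<Sum>j<n. A $$ (i, j) * x $ j)"
  by (simp add: scalar_prod_def atLeast0LessThan)

lemma one_smult_mult_mat_vec:
  fixes x :: "'a :: comm_ring_1 vec"
  assumes "x \<in> carrier_vec n"
  shows "(k \<cdot>\<^sub>m 1\<^sub>m n) *\<^sub>v x = k \<cdot>\<^sub>v x"
  using assms by (intro eq_vecI) (auto simp: row_smult)

text \<open>Each coordinate of \<open>x\<close> is at most the norm of \<open>x\<close>, so a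
  coordinate of \<open>A x\<close> is at most that norm times an absolute row sum. Any finite
  constant will do.\<close>

lemma mult_mat_vec_bounded:
  assumes A: "A \<in> carrier_mat m n"
  shows "\<exists>K>0. \<forall>x\<in>carrier_vec n. re_inner (A *\<^sub>v x) (A *\<^sub>v x) \<le> K * re_inner x x"
proof -
  \<comment> \<open>The summand 1 keeps \<open>K\<close> strictly positive even for the zero
    matrix.\<close>
  define K where "K = 1 + (\<Sum>i<m. (\<Sum>j<n. cmod (A $$ (i, j)))\<^sup>2)"
  have "K > 0" unfolding K_def by (smt (verit) sum_nonneg zero_le_power2)
  moreover have "re_inner (A *\<^sub>v x) (A *\<^sub>v x) \<le> K * re_inner x x" if x: "x \<in> carrier_vec n" for x
  proof -
    define N where "N = re_inner x x"
    have N0: "N \<ge> 0" unfolding N_def using x by (rule re_inner_self_nonneg)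
    have xj: "cmod (x $ j) \<le> sqrt N" if "j < n" for j
    proof -
      have "(cmod (x $ j))\<^sup>2 \<le> N" unfolding N_def re_inner_self[OF x]
        by (rule member_le_sum) (use that in auto)
      then show ?thesis by (simp add: real_le_rsqrt)
    qed
    have row: "(cmod ((A *\<^sub>v x) $ i))\<^sup>2 \<le> (\<Sum>j<n. cmod (A $$ (i, j)))\<^sup>2 * N" if "i < m" for i
    proof -
      have "cmod ((A *\<^sub>v x) $ i) \<le> (\<Sum>j<n. cmod (A $$ (i, j)) * cmod (x $ j))"
        unfolding index_mult_mat_vec_sum[OF A x that] norm_mult[symmetric] by (rule norm_sum)
      also have "\<dots> \<le> (\<Sum>j<n. cmod (A $$ (i, j)) * sqrt N)"
        by (intro sum_mono mult_left_mono) (use xj in auto)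
      also have "\<dots> = (\<Sum>j<n. cmod (A $$ (i, j))) * sqrt N" by (simp add: sum_distrib_right)
      finally have "(cmod ((A *\<^sub>v x) $ i))\<^sup>2 \<le> ((\<Sum>j<n. cmod (A $$ (i, j))) * sqrt N)\<^sup>2"
        by (intro power_mono) auto
      then show ?thesis using N0 by (simp add: power_mult_distrib)
    qed
    have Ax: "A *\<^sub>v x \<in> carrier_vec m" using A x by simp
    have "re_inner (A *\<^sub>v x) (A *\<^sub>v x) \<le> (\<Sum>i<m. (\<Sum>j<n. cmod (A $$ (i, j)))\<^sup>2 * N)"
      unfolding re_inner_self[OF Ax] by (intro sum_mono row) auto
    also have "\<dots> = (K - 1) * N" by (simp add: K_def sum_distrib_right)
    also have "\<dots> \<le> K * N" using N0 by (simp add: algebra_simps)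
    finally show ?thesis unfolding N_def .
  qed
  ultimately show ?thesis by blast
qed

text \<open>The product of two moduli is at most the sum of their squares, which reduces the form to
  the squared norms of \<open>A x\<close> and \<open>x\<close>.\<close>

lemma quadratic_form_bounded:
  assumes A: "A \<in> carrier_mat n n"
  shows "\<exists>C>0. \<forall>x\<in>carrier_vec n. \<bar>re_inner (A *\<^sub>v x) x\<bar> \<le> C * re_inner x x"
proof -
  obtain K where K: "K > 0"
    "\<And>x. x \<in> carrier_vec n \<Longrightarrow> re_inner (A *\<^sub>v x) (A *\<^sub>v x) \<le> K * re_inner x x"
    using mult_mat_vec_bounded[OF A] by blast
  have "\<bar>re_inner (A *\<^sub>v x) x\<bar> \<le> (K + 1) * re_inner x x" if x: "x \<in> carrier_vec n" for x
  proof -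
    have y: "A *\<^sub>v x \<in> carrier_vec n" using A x by simp
    have "\<bar>re_inner (A *\<^sub>v x) x\<bar> \<le> (\<Sum>i<n. \<bar>Re ((A *\<^sub>v x) $ i * cnj (x $ i))\<bar>)"
      unfolding re_inner_eq_sum[OF y x] by (rule sum_abs)
    also have "\<dots> \<le> (\<Sum>i<n. (cmod ((A *\<^sub>v x) $ i))\<^sup>2 + (cmod (x $ i))\<^sup>2)"
    proof (rule sum_mono)
      fix i
      have "\<bar>Re ((A *\<^sub>v x) $ i * cnj (x $ i))\<bar> \<le> cmod ((A *\<^sub>v x) $ i) * cmod (x $ i)"
        by (metis abs_Re_le_cmod complex_mod_cnj norm_mult)
      also have "\<dots> \<le> (cmod ((A *\<^sub>v x) $ i))\<^sup>2 + (cmod (x $ i))\<^sup>2"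
        using sum_squares_bound[of "cmod ((A *\<^sub>v x) $ i)" "cmod (x $ i)"]
          mult_nonneg_nonneg[OF norm_ge_zero[of "(A *\<^sub>v x) $ i"] norm_ge_zero[of "x $ i"]]
        by linarith
      finally show "\<bar>Re ((A *\<^sub>v x) $ i * cnj (x $ i))\<bar> \<le> (cmod ((A *\<^sub>v x) $ i))\<^sup>2 + (cmod (x $ i))\<^sup>2" .
    qed
    also have "\<dots> = re_inner (A *\<^sub>v x) (A *\<^sub>v x) + re_inner x x"
      by (simp add: re_inner_self[OF y] re_inner_self[OF x] sum.distrib)
    also have "\<dots> \<le> (K + 1) * re_inner x x" using K(2)[OF x] by (simp add: algebra_simps)
    finally show ?thesis .
  qed
  then show ?thesis using K(1) by (intro exI[of _ "K + 1"]) auto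
qed

text \<open>An injective square matrix has an inverse \<open>B\<close>; the upper bound for
  \<open>B\<close>, applied at \<open>A x\<close>, is the claim.\<close>

lemma mult_mat_vec_bounded_below:
  assumes A: "A \<in> carrier_mat n n"
    and inj: "\<And>x. x \<in> carrier_vec n \<Longrightarrow> A *\<^sub>v x = 0\<^sub>v n \<Longrightarrow> x = 0\<^sub>v n"
  shows "\<exists>K>0. \<forall>x\<in>carrier_vec n. re_inner x x \<le> K * re_inner (A *\<^sub>v x) (A *\<^sub>v x)"
proof -
  have "det A \<noteq> 0" using inj det_0_iff_vec_prod_zero[OF A] by blast
  from det_non_zero_imp_unit[OF A this, of "()"]
  obtain B where B: "B \<in> carrier_mat n n" and BA: "B * A = 1\<^sub>m n"
    unfolding Units_def ring_mat_def by auto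
  obtain K where K: "K > 0"
    "\<And>x. x \<in> carrier_vec n \<Longrightarrow> re_inner (B *\<^sub>v x) (B *\<^sub>v x) \<le> K * re_inner x x"
    using mult_mat_vec_bounded[OF B] by blast
  have "re_inner x x \<le> K * re_inner (A *\<^sub>v x) (A *\<^sub>v x)" if x: "x \<in> carrier_vec n" for x
  proof -
    have "B *\<^sub>v (A *\<^sub>v x) = x"
      using assoc_mult_mat_vec[OF B A x] BA x by simp
    then show ?thesis using K(2)[of "A *\<^sub>v x"] A x by simp
  qed
  then show ?thesis using K(1) by blast
qed

text \<open>Expanding the form at \<open>x - A x / C\<close>, where \<open>C\<close> bounds the form from above, shows that it
  dominates the squared norm of \<open>A x / C\<close>.\<close>
lemma positive_form_coercive:
  assumes A: "A \<in> carrier_mat n n"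
    and sa: "\<And>x y. x \<in> carrier_vec n \<Longrightarrow> y \<in> carrier_vec n \<Longrightarrow>
               re_inner (A *\<^sub>v x) y = re_inner x (A *\<^sub>v y)"
    and pos: "\<And>x. x \<in> carrier_vec n \<Longrightarrow> re_inner (A *\<^sub>v x) x \<ge> 0"
    and inj: "\<And>x. x \<in> carrier_vec n \<Longrightarrow> A *\<^sub>v x = 0\<^sub>v n \<Longrightarrow> x = 0\<^sub>v n"
  shows "\<exists>\<epsilon>>0. \<forall>x\<in>carrier_vec n. \<epsilon> * re_inner x x \<le> re_inner (A *\<^sub>v x) x"
proof -
  obtain K where K: "K > 0"
    "\<And>x. x \<in> carrier_vec n \<Longrightarrow> re_inner x x \<le> K * re_inner (A *\<^sub>v x) (A *\<^sub>v x)"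
    using mult_mat_vec_bounded_below[OF A inj] by blast
  obtain C where C: "C > 0"
    "\<And>x. x \<in> carrier_vec n \<Longrightarrow> \<bar>re_inner (A *\<^sub>v x) x\<bar> \<le> C * re_inner x x"
    using quadratic_form_bounded[OF A] by blast
  have "1 / (C * K) * re_inner x x \<le> re_inner (A *\<^sub>v x) x" if x: "x \<in> carrier_vec n" for x
  proof -
    define y where "y = A *\<^sub>v x"
    define N where "N = re_inner y y"
    have y: "y \<in> carrier_vec n" using A x y_def by simp
    have Ay: "A *\<^sub>v y \<in> carrier_vec n" using A y by simp
    \<comment> \<open>The form at \<open>x + a y\<close> is at most
      \<open>re_inner y x + (2 * a + a\<^sup>2 * C) * N\<close>. The choice
      \<open>a = - 1 / C\<close> minimizes the coefficient of \<open>N\<close>, with value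
      \<open>- 1 / C\<close>.\<close>
    define a where "a = - 1 / C"
    define s where "s = complex_of_real a"
    have sy: "s \<cdot>\<^sub>v y \<in> carrier_vec n" using y by simp
    have A_expand: "A *\<^sub>v (x + s \<cdot>\<^sub>v y) = y + s \<cdot>\<^sub>v (A *\<^sub>v y)"
      using mult_add_distrib_mat_vec[OF A x sy] mult_mat_vec[OF A y] by (simp add: y_def)
    have "0 \<le> re_inner (A *\<^sub>v (x + s \<cdot>\<^sub>v y)) (x + s \<cdot>\<^sub>v y)"
      using pos x sy by simp
    also have "\<dots> = re_inner y x + a * re_inner y y + a * (re_inner (A *\<^sub>v y) x
        + a * re_inner (A *\<^sub>v y) y)"
      unfolding A_expand unfolding s_def using x y Ay
      by (simp add: re_inner_add_left[of _ n] re_inner_add_right[of _ n]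
          re_inner_smult_left[of _ n] re_inner_smult_right[of _ n] algebra_simps)
    also have "re_inner (A *\<^sub>v y) x = N" using sa[OF y x] by (simp add: y_def N_def)
    also have "re_inner y y = N" by (simp add: N_def)
    finally have "0 \<le> re_inner y x - 2 * N / C + re_inner (A *\<^sub>v y) y / C\<^sup>2"
      by (simp add: a_def algebra_simps power2_eq_square add_divide_distrib)
    moreover have "re_inner (A *\<^sub>v y) y / C\<^sup>2 \<le> N / C"
    proof -
      have "re_inner (A *\<^sub>v y) y \<le> C * N" using C(2)[OF y] by (simp add: N_def)
      then have "re_inner (A *\<^sub>v y) y / C\<^sup>2 \<le> C * N / C\<^sup>2" by (rule divide_right_mono) simp
      then show ?thesis using C(1) by (simp add: power2_eq_square)
    qed
    ultimately have "N / C \<le> re_inner y x" by simp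
    \<comment> \<open>\<open>N\<close> is the squared norm of \<open>A x\<close>, so injectivity
      enters here, through the lower bound with constant \<open>K\<close>.\<close>
    moreover have "1 / (C * K) * re_inner x x \<le> N / C"
      using K(2)[OF x] K(1) C(1) by (simp add: N_def y_def field_simps)
    ultimately show ?thesis by (simp add: y_def)
  qed
  then show ?thesis using C(1) K(1) by (intro exI[of _ "1 / (C * K)"]) auto
qed

text \<open>The largest \<open>\<mu>\<close> for which \<open>A - \<mu> I\<close> is positive semidefinite is an eigenvalue, since otherwise
  \<open>A - \<mu> I\<close> would be coercive.\<close>
lemma lambda_min_rayleigh:
  assumes A: "A \<in> carrier_mat n n"
    and sa: "\<And>x y. x \<in> carrier_vec n \<Longrightarrow> y \<in> carrier_vec n \<Longrightarrow>
               re_inner (A *\<^sub>v x) y = re_inner x (A *\<^sub>v y)"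
    and x: "x \<in> carrier_vec n"
  shows "lambda_min A * re_inner x x \<le> re_inner (A *\<^sub>v x) x"
\<comment> \<open>In dimension 0 both sides vanish; otherwise a unit vector is available to bound
  \<open>L\<close> from above.\<close>
proof (cases "n = 0")
  case True
  then show ?thesis using x A by (simp add: re_inner_eq_sum[of _ 0])
next
  case False
  \<comment> \<open>The lower bounds of the Rayleigh quotient, written without division so that zero
    vectors need no exception.\<close>
  define L where "L = {\<mu>. \<forall>x\<in>carrier_vec n. \<mu> * re_inner x x \<le> re_inner (A *\<^sub>v x) x}"
  obtain C where C: "C > 0"
    "\<And>x. x \<in> carrier_vec n \<Longrightarrow> \<bar>re_inner (A *\<^sub>v x) x\<bar> \<le> C * re_inner x x"
    using quadratic_form_bounded[OF A] by blast
  have "- C \<in> L" unfolding L_def using C(2) by (fastforce simp: abs_le_iff)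
  then have L_ne: "L \<noteq> {}" by blast
  define u :: "complex vec" where "u = unit_vec n 0"
  have u: "u \<in> carrier_vec n" by (simp add: u_def)
  have "re_inner u u = (\<Sum>i<n. if i = 0 then 1 else 0)"
    unfolding re_inner_self[OF u] using False by (intro sum.cong) (auto simp: u_def unit_vec_def)
  then have uu: "re_inner u u = 1" using False by simp
  have L_bdd: "bdd_above L" unfolding L_def
    by (rule bdd_aboveI[of _ "re_inner (A *\<^sub>v u) u"]) (use u uu in force)
  define \<mu> where "\<mu> = Sup L"
  \<comment> \<open>The supremum is itself a member of \<open>L\<close>: for nonzero
    \<open>x\<close> every member lies below the quotient, and for squared norm 0 the bound by
    \<open>C\<close> forces the form to vanish.\<close>
  have \<mu>_L: "\<mu> * re_inner x x \<le> re_inner (A *\<^sub>v x) x" if x: "x \<in> carrier_vec n" for x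
  proof (cases "re_inner x x = 0")
    case True
    then show ?thesis using C(2)[OF x] by simp
  next
    case False
    then have p: "re_inner x x > 0" using re_inner_self_nonneg[OF x] by simp
    have "\<mu> \<le> re_inner (A *\<^sub>v x) x / re_inner x x" unfolding \<mu>_def
      by (rule cSup_least[OF L_ne]) (use x p in \<open>auto simp: L_def field_simps\<close>)
    then show ?thesis using p by (simp add: field_simps)
  qed
  define S where "S = A + complex_of_real (- \<mu>) \<cdot>\<^sub>m 1\<^sub>m n"
  have S: "S \<in> carrier_mat n n" using A by (simp add: S_def)
  have Sx: "S *\<^sub>v x = A *\<^sub>v x + complex_of_real (- \<mu>) \<cdot>\<^sub>v x" if "x \<in> carrier_vec n" for x
    unfolding S_def using A that
    by (subst add_mult_distrib_mat_vec[of _ n n]) (auto simp: one_smult_mult_mat_vec)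
  have Ax: "A *\<^sub>v x \<in> carrier_vec n" if "x \<in> carrier_vec n" for x using A that by simp
  have Sform: "re_inner (S *\<^sub>v x) y = re_inner (A *\<^sub>v x) y - \<mu> * re_inner x y"
    if "x \<in> carrier_vec n" "y \<in> carrier_vec n" for x y
    unfolding Sx[OF that(1)] using that Ax
    by (subst re_inner_add_left[of _ n]) (auto simp: re_inner_smult_left[of _ n] simp del: of_real_minus)
  have "\<exists>v\<in>carrier_vec n. S *\<^sub>v v = 0\<^sub>v n \<and> v \<noteq> 0\<^sub>v n"
  proof (rule ccontr)
    assume "\<not> ?thesis"
    then have inj: "v = 0\<^sub>v n" if "v \<in> carrier_vec n" "S *\<^sub>v v = 0\<^sub>v n" for v using that by blast
    have sym: "re_inner (S *\<^sub>v x) y = re_inner x (S *\<^sub>v y)"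
      if "x \<in> carrier_vec n" "y \<in> carrier_vec n" for x y
    proof -
      have "re_inner x (S *\<^sub>v y) = re_inner (S *\<^sub>v y) x"
        using that S by (simp add: re_inner_comm[of x n])
      also have "\<dots> = re_inner (A *\<^sub>v y) x - \<mu> * re_inner y x" by (rule Sform) (use that in auto)
      also have "re_inner (A *\<^sub>v y) x = re_inner (A *\<^sub>v x) y"
        using sa[OF that] re_inner_comm[OF that(1) Ax[OF that(2)]] by simp
      also have "re_inner y x = re_inner x y" using that by (rule re_inner_comm[rotated])
      finally show ?thesis using Sform[OF that] by simp
    qed
    have pos: "0 \<le> re_inner (S *\<^sub>v x) x" if "x \<in> carrier_vec n" for x
      using \<mu>_L[OF that] Sform[OF that that] by simp
    obtain \<epsilon> where \<epsilon>: "\<epsilon> > 0"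
      "\<And>x. x \<in> carrier_vec n \<Longrightarrow> \<epsilon> * re_inner x x \<le> re_inner (S *\<^sub>v x) x"
      using positive_form_coercive[OF S sym pos inj] by blast
    \<comment> \<open>Coercivity leaves room to raise the lower bound by \<open>\<epsilon>\<close>,
      past the supremum.\<close>
    have "\<mu> + \<epsilon> \<in> L" unfolding L_def using \<epsilon>(2) by (auto simp: Sform algebra_simps)
    then have "\<mu> + \<epsilon> \<le> \<mu>" unfolding \<mu>_def using L_bdd by (rule cSup_upper)
    then show False using \<epsilon>(1) by simp
  qed
  then obtain v where v: "v \<in> carrier_vec n" "v \<noteq> 0\<^sub>v n" and Sv: "S *\<^sub>v v = 0\<^sub>v n" by blast
  have "A *\<^sub>v v = complex_of_real \<mu> \<cdot>\<^sub>v v"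
  proof (rule eq_vecI)
    fix i assume "i < dim_vec (complex_of_real \<mu> \<cdot>\<^sub>v v)"
    then have i: "i < n" using v(1) by simp
    have "(A *\<^sub>v v + complex_of_real (- \<mu>) \<cdot>\<^sub>v v) $ i = 0"
      using Sv i unfolding Sx[OF v(1)] by simp
    then show "(A *\<^sub>v v) $ i = (complex_of_real \<mu> \<cdot>\<^sub>v v) $ i"
      using i v(1) A by simp
  qed (use A v in simp)
  then have ev: "eigenvalue A (complex_of_real \<mu>)"
    unfolding eigenvalue_def eigenvector_def using v A by auto
  \<comment> \<open>\<open>Min\<close> is meaningful only on a finite set, and the spectrum is
    finite. The minimum is then at most the eigenvalue \<open>\<mu>\<close>, which is the direction
    required.\<close>
  have "finite (complex_of_real -` spectrum A)"
    by (rule finite_vimageI) (auto simp: card_finite_spectrum[OF A] inj_on_def)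
  then have "finite {l. eigenvalue A (complex_of_real l)}"
    by (simp add: spectrum_def vimage_def)
  then have "lambda_min A \<le> \<mu>" unfolding lambda_min_def using ev by (intro Min_le) auto
  then have "lambda_min A * re_inner x x \<le> \<mu> * re_inner x x"
    by (rule mult_right_mono) (rule re_inner_self_nonneg[OF x])
  also have "\<dots> \<le> re_inner (A *\<^sub>v x) x" by (rule \<mu>_L[OF x])
  finally show ?thesis .
qed

section \<open>The adjoint and the real inner product\<close>

lemma mat_adjoint_carrier: "A \<in> carrier_mat m n \<Longrightarrow> mat_adjoint A \<in> carrier_mat n m"
  by (intro carrier_matI) (simp_all add: mat_adjoint_def)

lemma mat_adjoint_index:
  "A \<in> carrier_mat m n \<Longrightarrow> i < n \<Longrightarrow> j < m \<Longrightarrow> mat_adjoint A $$ (i, j) = cnj (A $$ (j, i))"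
  by (simp add: mat_adjoint_def mat_of_rows_def)

lemma re_inner_adjoint:
  assumes A: "A \<in> carrier_mat m n" and x: "x \<in> carrier_vec m" and y: "y \<in> carrier_vec n"
  shows "re_inner (mat_adjoint A *\<^sub>v x) y = re_inner x (A *\<^sub>v y)"
proof -
  have B: "mat_adjoint A \<in> carrier_mat n m" by (rule mat_adjoint_carrier[OF A])
  have "re_inner (mat_adjoint A *\<^sub>v x) y = Re (\<Sum>i<n. \<Sum>j<m. cnj (A $$ (j, i)) * x $ j * cnj (y $ i))"
    using A B x y by (subst re_inner_eq_sum[of _ n])
      (auto simp: index_mult_mat_vec_sum[OF B x] mat_adjoint_index[OF A] sum_distrib_right
       simp del: index_mult_mat_vec intro!: sum.cong)
  also have "\<dots> = Re (\<Sum>j<m. \<Sum>i<n. cnj (A $$ (j, i)) * x $ j * cnj (y $ i))"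
    by (subst sum.swap) simp
  also have "\<dots> = re_inner x (A *\<^sub>v y)"
    using A B x y by (subst re_inner_eq_sum[of _ m])
      (auto simp: index_mult_mat_vec_sum[OF A y] sum_distrib_left mult_ac
       simp del: index_mult_mat_vec intro!: sum.cong)
  finally show ?thesis .
qed

section \<open>Separation of constellation points\<close>

text \<open>The angle lies between \<open>pi / M\<close> and \<open>pi - pi / M\<close>. Either it
  or its supplement lies in the range up to \<open>pi / 2\<close>, where sine increases, and both
  have the same sine.\<close>

lemma sin_pi_frac_ge:
  assumes "1 \<le> d" "d < M"
  shows "sin (pi / real M) \<le> sin (real d * pi / real M)"
proof -
  have M: "0 < real M" using assms by simp
  have low: "pi / M \<le> d * pi / M" using assms M by (intro divide_right_mono) auto
  have refl: "pi - d * pi / M = (real M - d) * pi / M" using M by (simp add: field_simps)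
  have high: "pi / M \<le> pi - d * pi / M"
    unfolding refl using assms M by (intro divide_right_mono) auto
  have nonneg: "0 \<le> pi / M" by simp
  show ?thesis
  proof (cases "d * pi / M \<le> pi / 2")
    case True
    then show ?thesis using low nonneg by (intro sin_monotone_2pi_le) linarith+
  next
    case False
    then have "sin (pi / M) \<le> sin (pi - d * pi / M)"
      using high nonneg by (intro sin_monotone_2pi_le) linarith+
    then show ?thesis by simp
  qed
qed

lemma psk_point_eq_cis: "psk_point M k = cis (phase M k)"
  by (simp add: psk_point_def cis_conv_exp)

text \<open>The chord length formula; the squares of both sides equal
  \<open>2 - 2 * cos (a - b)\<close>.\<close>

lemma cmod_cis_diff: "cmod (cis a - cis b) = 2 * \<bar>sin ((a - b) / 2)\<bar>"
proof -
  have half: "2 * ((a - b) / 2) = a - b" by simp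
  have "(cmod (cis a - cis b))\<^sup>2 = (cos a - cos b)\<^sup>2 + (sin a - sin b)\<^sup>2"
    by (simp add: cmod_power2)
  also have "\<dots> = 2 - 2 * cos (a - b)"
    using sin_cos_squared_add[of a] sin_cos_squared_add[of b]
    by (simp add: cos_diff power2_diff algebra_simps)
  also have "\<dots> = (2 * \<bar>sin ((a - b) / 2)\<bar>)\<^sup>2"
    using cos_double_sin[of "(a - b) / 2", unfolded half] by (simp add: power_mult_distrib)
  finally show ?thesis by (rule power2_eq_imp_eq) auto
qed

text \<open>Half the angle between the two points is a multiple of \<open>pi / M\<close> by a factor
  from 1 to \<open>M - 1\<close>, so neighbouring points are the closest ones.\<close>

lemma psk_point_separation:
  assumes "k < M" "l < M" "k \<noteq> l"
  shows "2 * sin (pi / real M) \<le> cmod (psk_point M (k + 1) - psk_point M (l + 1))"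
  using assms
\<comment> \<open>Ordering the indices makes the natural-number difference \<open>l - k\<close> a
  genuine one.\<close>
proof (induction k l rule: linorder_wlog)
  case (le k l)
  have "(phase M (l + 1) - phase M (k + 1)) / 2 = real (l - k) * pi / M"
    using le by (simp add: phase_def field_simps of_nat_diff)
  moreover have "sin (pi / M) \<le> sin (real (l - k) * pi / M)"
    by (rule sin_pi_frac_ge) (use le in auto)
  ultimately have "2 * sin (pi / M) \<le> cmod (psk_point M (l + 1) - psk_point M (k + 1))"
    unfolding psk_point_eq_cis cmod_cis_diff by simp
  then show ?case by (simp add: norm_minus_commute)
next
  case (sym k l)
  then show ?case by (simp add: norm_minus_commute)
qed

lemma sin_pi_over_pos: "M \<ge> 2 \<Longrightarrow> 0 < sin (pi / real M)"
  by (rule sin_gt_zero) (auto simp: field_simps)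

lemma psk_point_inj:
  assumes "M \<ge> 2" "k < M" "l < M" "psk_point M (k + 1) = psk_point M (l + 1)"
  shows "k = l"
  using psk_point_separation[of k M l] sin_pi_over_pos[of M] assms by fastforce

section \<open>Feasible points\<close>

lemma block_index_less: "j < n \<Longrightarrow> k < M \<Longrightarrow> j * M + k < n * (M :: nat)"
proof -
  assume "j < n" "k < M"
  then have "j * M + k < Suc j * M" by simp
  also have "\<dots> \<le> n * M" using \<open>j < n\<close> by (intro mult_le_mono1) simp
  finally show ?thesis .
qed

lemma sum_blocks:
  fixes F :: "nat \<Rightarrow> 'a :: comm_monoid_add"
  shows "(\<Sum>i<n * M. F i) = (\<Sum>j<n. \<Sum>k<M. F (j * M + k))"
proof -
  have block: "sum F {j * M..<j * M + M} = (\<Sum>k<M. F (j * M + k))" for j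
    using sum.shift_bounds_nat_ivl[of F 0 "j * M" M] by (simp add: atLeast0LessThan add.commute)
  have "(\<Sum>i<n * M. F i) = (\<Sum>j<n. sum F {j * M..<j * M + M})"
    by (rule sum.nat_group[symmetric])
  also have "\<dots> = (\<Sum>j<n. \<Sum>k<M. F (j * M + k))"
    by (simp only: block)
  finally show ?thesis .
qed

text \<open>Encodes one choice per block by an index function rather than by a complex vector, so
  that the combinatorics of the feasible set involves no constellation points.\<close>

definition selector_vec :: "nat \<Rightarrow> nat \<Rightarrow> (nat \<Rightarrow> nat) \<Rightarrow> real vec" where
  "selector_vec n M k = vec (n * M) (\<lambda>i. if i mod M = k (i div M) then 1 else 0)"

lemma selector_vec_carrier: "selector_vec n M k \<in> carrier_vec (n * M)"
  by (simp add: selector_vec_def)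

lemma selector_vec_block:
  "j < n \<Longrightarrow> a < M \<Longrightarrow> selector_vec n M k $ (j * M + a) = (if a = k j then 1 else 0)"
  by (simp add: selector_vec_def block_index_less)

text \<open>Only one term per block survives. This collapses both sums of the quadratic term and the
  sum of the linear term of the objective.\<close>

lemma sum_selector_vec:
  assumes "\<And>j. j < n \<Longrightarrow> k j < M"
  shows "(\<Sum>a<n * M. selector_vec n M k $ a * F a) = (\<Sum>j<n. F (j * M + k j))"
  unfolding sum_blocks using assms
  by (intro sum.cong refl) (simp add: selector_vec_block if_distrib[of "\<lambda>c. c * _"] cong: if_cong)

text \<open>Each block contains a single 1, and the support is contained in the image of
  \<open>{..<n}\<close> under \<open>\<lambda>j. j * M + k j\<close>.\<close>

lemma sqp2_feasible_selector:
  assumes "\<And>j. j < n \<Longrightarrow> k j < M"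
  shows "sqp2_feasible n M (selector_vec n M k)"
proof -
  let ?t = "selector_vec n M k"
  have "ones_vec M \<bullet> block_vec M ?t j = 1" if "j < n" for j
    using that assms[OF that]
    by (simp add: ones_vec_def block_vec_def scalar_prod_def selector_vec_block atLeast0LessThan)
  moreover have "0\<^sub>v (n * M) \<le> ?t" by (simp add: less_eq_vec_def selector_vec_def)
  moreover have "l0_norm ?t \<le> n"
  proof -
    have "l0_norm ?t \<le> card ((\<lambda>j. j * M + k j) ` {..<n})" unfolding l0_norm_def
    proof (rule card_mono, simp, rule subsetI)
      fix i assume "i \<in> {i. i < dim_vec ?t \<and> ?t $ i \<noteq> 0}"
      then have i: "i < n * M" "i mod M = k (i div M)"
        by (auto simp: selector_vec_def split: if_splits)
      then have "i = (i div M) * M + k (i div M)" by (metis div_mult_mod_eq)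
      moreover have "i div M < n" using i(1) by (simp add: less_mult_imp_div_less)
      ultimately show "i \<in> (\<lambda>j. j * M + k j) ` {..<n}" by blast
    qed
    also have "\<dots> \<le> n" using card_image_le[of "{..<n}" "\<lambda>j. j * M + k j"] by simp
    finally show ?thesis .
  qed
  ultimately show ?thesis by (simp add: sqp2_feasible_def selector_vec_carrier)
qed

text \<open>Every block has a nonzero entry since its entries sum to 1, and the cardinality constraint
  leaves room for only one per block.\<close>
lemma sqp2_feasible_imp_selector:
  assumes "sqp2_feasible n M t"
  shows "\<exists>k. (\<forall>j<n. k j < M) \<and> t = selector_vec n M k"
proof -
  have t: "t \<in> carrier_vec (n * M)" and l0: "l0_norm t \<le> n"
    using assms by (auto simp: sqp2_feasible_def)
  have blk: "(\<Sum>a<M. t $ (j * M + a)) = 1" if "j < n" for j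
    using assms that
    by (simp add: sqp2_feasible_def ones_vec_def block_vec_def scalar_prod_def atLeast0LessThan)
  define N where "N j = {a. a < M \<and> t $ (j * M + a) \<noteq> 0}" for j
  have fin: "finite (N j)" for j by (simp add: N_def)
  have ge1: "1 \<le> card (N j)" if "j < n" for j
  proof -
    have "N j \<noteq> {}"
    proof
      assume "N j = {}"
      then have "(\<Sum>a<M. t $ (j * M + a)) = 0" by (intro sum.neutral) (auto simp: N_def)
      then show False using blk[OF that] by simp
    qed
    then show ?thesis using fin[of j] by (simp add: Suc_leI card_gt_0_iff)
  qed
  \<comment> \<open>The number of nonzero entries is the sum of the block support sizes.\<close>
  have "l0_norm t = (\<Sum>i<n * M. if t $ i \<noteq> 0 then 1 else 0)"
    using t unfolding l0_norm_def by (simp add: sum.If_cases Int_def lessThan_def)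
  also have "\<dots> = (\<Sum>j<n. card (N j))"
    unfolding sum_blocks by (simp add: N_def sum.If_cases Int_def lessThan_def)
  finally have tot: "(\<Sum>j<n. card (N j)) \<le> n" using l0 by simp
  have eq1: "card (N j) = 1" if "j < n" for j
  proof (rule ccontr)
    assume "card (N j) \<noteq> 1"
    \<comment> \<open>Every summand is at least 1, so a single deviating block pushes the total
      above \<open>n\<close>.\<close>
    then have "(\<Sum>j<n. 1) < (\<Sum>j<n. card (N j))"
      using ge1 that by (intro sum_strict_mono_ex1) (force intro!: bexI[of _ j])+
    then show False using tot by simp
  qed
  then have "\<forall>j. \<exists>a. j < n \<longrightarrow> N j = {a}" by (metis card_1_singletonE)
  then obtain k where k: "N j = {k j}" if "j < n" for j by metis
  have kM: "k j < M" if "j < n" for j using k[OF that] by (auto simp: N_def)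
  have off: "t $ (j * M + a) = 0" if "j < n" "a < M" "a \<noteq> k j" for j a
    using k[OF that(1)] that by (auto simp: N_def)
  \<comment> \<open>The only nonzero entry of a block carries the whole block sum.\<close>
  have on: "t $ (j * M + k j) = 1" if "j < n" for j
  proof -
    have "(\<Sum>a<M. t $ (j * M + a)) = (\<Sum>a<M. if a = k j then t $ (j * M + k j) else 0)"
      by (intro sum.cong refl) (use off that in auto)
    then show ?thesis using blk[OF that] kM[OF that] by simp
  qed
  have "t = selector_vec n M k"
  proof (rule eq_vecI)
    fix i assume "i < dim_vec (selector_vec n M k)"
    then have i: "i < n * M" by (simp add: selector_vec_def)
    then have j: "i div M < n" and M: "M > 0"
      by (auto simp: less_mult_imp_div_less intro: gr0I)
    have "t $ (j * M + a) = selector_vec n M k $ (j * M + a)" if "j < n" "a < M" for j a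
      using that off on by (cases "a = k j") (auto simp: selector_vec_block)
    from this[OF j, of "i mod M"] M show "t $ i = selector_vec n M k $ i" by simp
  qed (use t in \<open>simp add: selector_vec_def\<close>)
  then show ?thesis using kM by blast
qed

text \<open>Distinct indices give distinct constellation points, so comparing points in
  \<open>assignment_vec\<close> amounts to comparing indices.\<close>

lemma assignment_vec_eq_selector:
  assumes "M \<ge> 2" and k: "\<And>j. j < n \<Longrightarrow> k j < M" and "x \<in> carrier_vec n"
    and x: "\<And>j. j < n \<Longrightarrow> x $ j = psk_point M (k j + 1)"
  shows "assignment_vec n M x = selector_vec n M k"
proof (rule eq_vecI)
  fix i assume "i < dim_vec (selector_vec n M k)"
  then have i: "i < n * M" by (simp add: selector_vec_def)
  then have j: "i div M < n" by (simp add: less_mult_imp_div_less)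
  have "i mod M < M" using \<open>M \<ge> 2\<close> by simp
  then have "x $ (i div M) = psk_point M (i mod M + 1) \<longleftrightarrow> i mod M = k (i div M)"
    using psk_point_inj[OF \<open>M \<ge> 2\<close> k[OF j], of "i mod M"] x[OF j] by auto
  then show "assignment_vec n M x $ i = selector_vec n M k $ i"
    using i by (simp add: assignment_vec_def selector_vec_def)
qed (simp add: assignment_vec_def selector_vec_def)

section \<open>The objective on assignment vectors\<close>

lemma realify_mat_carrier: "Q \<in> carrier_mat m n \<Longrightarrow> realify_mat Q \<in> carrier_mat (m + m) (n + n)"
  by (simp add: realify_mat_def)

lemma realify_vec_inner:
  assumes x: "x \<in> carrier_vec n" and y: "y \<in> carrier_vec n"
  shows "realify_vec x \<bullet> realify_vec y = re_inner x y"
proof -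
  have "realify_vec x \<bullet> realify_vec y
      = map_vec Re x \<bullet> map_vec Re y + map_vec Im x \<bullet> map_vec Im y"
    unfolding realify_vec_def by (rule scalar_prod_append) (use x y in auto)
  also have "\<dots> = re_inner x y"
    using x y by (simp add: re_inner_eq_sum[of _ n] scalar_prod_def atLeast0LessThan sum.distrib)
  finally show ?thesis .
qed

text \<open>The blocks of the product are the real and imaginary parts of
  \<open>(Re Q + \<i> Im Q) (Re y + \<i> Im y)\<close>.\<close>

lemma realify_mat_mult_vec:
  assumes Q: "Q \<in> carrier_mat m n" and y: "y \<in> carrier_vec n"
  shows "realify_mat Q *\<^sub>v realify_vec y = realify_vec (Q *\<^sub>v y)"
proof -
  have "realify_mat Q *\<^sub>v realify_vec y =
      (map_mat Re Q *\<^sub>v map_vec Re y + - map_mat Im Q *\<^sub>v map_vec Im y) @\<^sub>v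
      (map_mat Im Q *\<^sub>v map_vec Re y + map_mat Re Q *\<^sub>v map_vec Im y)"
    unfolding realify_mat_def realify_vec_def
    by (rule four_block_mat_mult_vec) (use Q y in auto)
  also have "map_mat Re Q *\<^sub>v map_vec Re y + - map_mat Im Q *\<^sub>v map_vec Im y = map_vec Re (Q *\<^sub>v y)"
    using Q y by (intro eq_vecI) (auto simp: scalar_prod_def sum_subtractf sum_negf)
  also have "map_mat Im Q *\<^sub>v map_vec Re y + map_mat Re Q *\<^sub>v map_vec Im y = map_vec Im (Q *\<^sub>v y)"
    using Q y by (intro eq_vecI) (auto simp: scalar_prod_def sum.distrib)
  finally show ?thesis by (simp add: realify_vec_def)
qed

section \<open>Columns of \<open>P\<close> and entries of \<open>G\<close> and
  \<open>w\<close>\<close>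

lemma P_mat_carrier: "P_mat n M \<in> carrier_mat (n + n) (n * M)"
  unfolding P_mat_def
  by (intro carrier_append_rows carrier_matI) (simp_all add: kronecker_def alpha_vec_def beta_vec_def)

text \<open>With this description, products with \<open>P\<close> become complex inner products with
  scaled unit vectors, and the Kronecker products need not be unfolded again.\<close>

lemma P_mat_col:
  assumes b: "b < n * M"
  shows "col (P_mat n M) b = realify_vec (psk_point M (b mod M + 1) \<cdot>\<^sub>v unit_vec n (b div M))"
proof (rule eq_vecI)
  have bn: "b div M < n" and bM: "b mod M < M"
    using b by (auto simp: less_mult_imp_div_less intro!: mod_less_divisor gr0I)
  show "dim_vec (col (P_mat n M) b) =
      dim_vec (realify_vec (psk_point M (b mod M + 1) \<cdot>\<^sub>v unit_vec n (b div M)))"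
    using P_mat_carrier[of n M] by (simp add: realify_vec_def)
  fix i assume "i < dim_vec (realify_vec (psk_point M (b mod M + 1) \<cdot>\<^sub>v unit_vec n (b div M)))"
  then have i: "i < n + n" by (simp add: realify_vec_def)
  have "col (P_mat n M) b $ i = P_mat n M $$ (i, b)"
    using P_mat_carrier[of n M] i b by auto
  also have "\<dots> = realify_vec (psk_point M (b mod M + 1) \<cdot>\<^sub>v unit_vec n (b div M)) $ i"
    using i b bn bM
    by (auto simp: P_mat_def append_rows_def kronecker_def alpha_vec_def beta_vec_def realify_vec_def
        psk_point_eq_cis unit_vec_def)
  finally show "col (P_mat n M) b $ i = \<dots>" .
qed

lemma re_inner_unit_left:
  "i < n \<Longrightarrow> y \<in> carrier_vec n \<Longrightarrow> re_inner (z \<cdot>\<^sub>v unit_vec n i) y = Re (z * cnj (y $ i))"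
proof -
  assume i: "i < n" and y: "y \<in> carrier_vec n"
  have "re_inner (z \<cdot>\<^sub>v unit_vec n i) y = (\<Sum>j<n. if j = i then Re (z * cnj (y $ i)) else 0)"
    by (subst re_inner_eq_sum[OF _ y], simp, intro sum.cong refl) (auto simp: unit_vec_def)
  then show ?thesis using i by simp
qed

lemma G_mat_carrier:
  assumes "H \<in> carrier_mat m n"
  shows "G_mat n M H \<in> carrier_mat (n * M) (n * M)"
  unfolding G_mat_def using carrier_matD[OF P_mat_carrier[of n M]] by (intro carrier_matI) auto

text \<open>The entry pairs column \<open>a\<close> of \<open>P\<close> with the realified
  \<open>Q\<close> applied to column \<open>b\<close>; since realification preserves inner products
  and matrix action, it can be evaluated over the complex numbers.\<close>

lemma G_mat_index:
  assumes H: "H \<in> carrier_mat m n" and a: "a < n * M" and b: "b < n * M"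
  shows "G_mat n M H $$ (a, b) = Re (psk_point M (a mod M + 1) *
           cnj (Q_mat H $$ (a div M, b div M) * psk_point M (b mod M + 1)))"
proof -
  let ?u = "\<lambda>a. psk_point M (a mod M + 1) \<cdot>\<^sub>v unit_vec n (a div M)"
  have P: "P_mat n M \<in> carrier_mat (n + n) (n * M)" by (rule P_mat_carrier)
  have Q: "Q_mat H \<in> carrier_mat n n"
    unfolding Q_mat_def using mat_adjoint_carrier[OF H] H by simp
  note RQ = realify_mat_carrier[OF Q]
  have an: "a div M < n" and bn: "b div M < n"
    using a b by (auto simp: less_mult_imp_div_less)
  have "G_mat n M H = transpose_mat (P_mat n M) * (realify_mat (Q_mat H) * P_mat n M)"
    unfolding G_mat_def using P RQ by (intro assoc_mult_mat) auto
  then have "G_mat n M H $$ (a, b) = col (P_mat n M) a \<bullet> (realify_mat (Q_mat H) *\<^sub>v col (P_mat n M) b)"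
    using P RQ a b by (simp add: col_mult2[OF RQ P] mult_mat_vec_def)
  also have "\<dots> = realify_vec (?u a) \<bullet> realify_vec (Q_mat H *\<^sub>v ?u b)"
    unfolding P_mat_col[OF a] P_mat_col[OF b] by (subst realify_mat_mult_vec[OF Q]) auto
  also have "\<dots> = re_inner (?u a) (Q_mat H *\<^sub>v ?u b)"
    by (rule realify_vec_inner[of _ n]) (use Q in auto)
  also have "\<dots> = Re (psk_point M (a mod M + 1) * cnj ((Q_mat H *\<^sub>v ?u b) $ (a div M)))"
    by (rule re_inner_unit_left[OF an]) (use Q in auto)
  also have "(Q_mat H *\<^sub>v ?u b) $ (a div M) = Q_mat H $$ (a div M, b div M) * psk_point M (b mod M + 1)"
    using Q an bn by simp
  finally show ?thesis .
qed

lemma w_vec_index: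
  assumes H: "H \<in> carrier_mat m n" and r: "r \<in> carrier_vec m" and a: "a < n * M"
  shows "w_vec n M H r $ a = Re (psk_point M (a mod M + 1) * cnj (c_vec H r $ (a div M)))"
proof -
  have P: "P_mat n M \<in> carrier_mat (n + n) (n * M)" by (rule P_mat_carrier)
  have c: "c_vec H r \<in> carrier_vec n"
    unfolding c_vec_def using mult_mat_vec_carrier[OF mat_adjoint_carrier[OF H] r] by simp
  have an: "a div M < n" using a by (simp add: less_mult_imp_div_less)
  have "w_vec n M H r $ a = col (P_mat n M) a \<bullet> realify_vec (c_vec H r)"
    unfolding w_vec_def using P a by simp
  also have "\<dots> = re_inner (psk_point M (a mod M + 1) \<cdot>\<^sub>v unit_vec n (a div M)) (c_vec H r)"
    unfolding P_mat_col[OF a] by (rule realify_vec_inner[of _ n]) (use c in auto)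
  also have "\<dots> = Re (psk_point M (a mod M + 1) * cnj (c_vec H r $ (a div M)))"
    by (rule re_inner_unit_left[OF an c])
  finally show ?thesis .
qed

section \<open>Removal of the diagonal blocks and the resulting objective\<close>

text \<open>Induction on the number of blocks, the last one being appended in the lower right
  corner. The dimensions belong to the claim because the induction step must know where that corner
  starts.\<close>

lemma diag_block_mat_index:
  assumes "\<And>j. f j \<in> carrier_mat M M"
  shows "diag_block_mat (map f [0..<n]) \<in> carrier_mat (n * M) (n * M) \<and>
    (\<forall>a<n * M. \<forall>b<n * M. diag_block_mat (map f [0..<n]) $$ (a, b) =
       (if a div M = b div M then f (a div M) $$ (a mod M, b mod M) else 0))"
proof (induction n)
  case 0
  then show ?case by auto
next
  case (Suc n)
  let ?D = "diag_block_mat (map f [0..<n])"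
  have D: "?D \<in> carrier_mat (n * M) (n * M)"
    and IH: "\<And>a b. a < n * M \<Longrightarrow> b < n * M \<Longrightarrow> ?D $$ (a, b) =
       (if a div M = b div M then f (a div M) $$ (a mod M, b mod M) else 0)"
    using Suc.IH by auto
  have eq: "diag_block_mat (map f [0..<Suc n]) =
      four_block_mat ?D (0\<^sub>m (n * M) M) (0\<^sub>m M (n * M)) (f n)"
    using D assms[of n] by (simp add: diag_block_mat_last Let_def)
  \<comment> \<open>For an index in the appended block, the offset past \<open>n * M\<close> is its
    remainder modulo \<open>M\<close>.\<close>
  have last: "a div M = n \<and> a - n * M = a mod M" if "\<not> a < n * M" "a < Suc n * M" for a
  proof -
    have "a div M = n" using that by (intro div_nat_eqI) (auto simp: mult.commute)
    then show ?thesis by (metis minus_div_mult_eq_mod)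
  qed
  have less: "a div M < n" if "a < n * M" for a using that by (simp add: less_mult_imp_div_less)
  show ?case
  proof (intro conjI allI impI)
    show "diag_block_mat (map f [0..<Suc n]) \<in> carrier_mat (Suc n * M) (Suc n * M)"
      unfolding eq using D assms[of n] by (auto simp: add.commute)
    fix a b assume a: "a < Suc n * M" and b: "b < Suc n * M"
    have "diag_block_mat (map f [0..<Suc n]) $$ (a, b) =
      (if a < n * M then if b < n * M then ?D $$ (a, b) else 0
       else if b < n * M then 0 else f n $$ (a - n * M, b - n * M))"
      unfolding eq using carrier_matD[OF D] carrier_matD[OF assms[of n]] a b
      by (subst index_mat_four_block) auto
    also have "\<dots> = (if a div M = b div M then f (a div M) $$ (a mod M, b mod M) else 0)"
      by (cases "a < n * M"; cases "b < n * M")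
        (use IH[of a b] last[of a] last[of b] less[of a] less[of b] a b in simp_all)
    finally show "diag_block_mat (map f [0..<Suc n]) $$ (a, b) = \<dots>" .
  qed
qed

lemma G_tilde_index:
  assumes H: "H \<in> carrier_mat m n" and a: "a < n * M" and b: "b < n * M"
  shows "G_tilde n M H $$ (a, b) = (if a div M = b div M then 0 else G_mat n M H $$ (a, b))"
proof -
  let ?f = "\<lambda>j. block_mat M (G_mat n M H) j j"
  have "a mod M < M" "b mod M < M" using a b by (auto intro!: mod_less_divisor gr0I)
  moreover have "D_tilde n M H \<in> carrier_mat (n * M) (n * M)"
    and "D_tilde n M H $$ (a, b) = (if a div M = b div M then ?f (a div M) $$ (a mod M, b mod M) else 0)"
    using diag_block_mat_index[of ?f M n] a b unfolding D_tilde_def by (auto simp: block_mat_def)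
  \<comment> \<open>For row and column in the same block, the index rebuilt by
    \<open>block_mat\<close> is the original one, so the entry of \<open>G\<close> is subtracted
    from itself.\<close>
  moreover have "b div M * M + a mod M = a" if "a div M = b div M"
    using that by (metis div_mult_mod_eq)
  ultimately show ?thesis
    using a b G_mat_carrier[OF H, of M] by (auto simp: G_tilde_def block_mat_def)
qed

lemma G_tilde_carrier:
  assumes H: "H \<in> carrier_mat m n"
  shows "G_tilde n M H \<in> carrier_mat (n * M) (n * M)"
proof -
  have "D_tilde n M H \<in> carrier_mat (n * M) (n * M)"
    using diag_block_mat_index[of "\<lambda>j. block_mat M (G_mat n M H) j j" M n]
    unfolding D_tilde_def by (auto simp: block_mat_def)
  then show ?thesis unfolding G_tilde_def by (rule minus_carrier_mat)
qed

text \<open>The removed diagonal blocks contribute the constant \<open>\<Sum>i. Re Q\<^sub>i\<^sub>i\<close> because constellation points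
  have modulus 1.\<close>
lemma sqp2_objective_selector:
  assumes H: "H \<in> carrier_mat m n" and r: "r \<in> carrier_vec m"
    and k: "\<And>j. j < n \<Longrightarrow> k j < M"
    and x: "x = vec n (\<lambda>j. psk_point M (k j + 1))"
  shows "sqp2_objective n M H r (selector_vec n M k) =
    re_inner x (Q_mat H *\<^sub>v x) + 2 * re_inner x (c_vec H r) - (\<Sum>i<n. Re (Q_mat H $$ (i, i)))"
proof -
  let ?t = "selector_vec n M k"
  \<comment> \<open>The contribution of a coordinate pair to
    \<open>re_inner x (Q_mat H *\<^sub>v x)\<close>.\<close>
  define q where "q i j = Re (x $ i * cnj (Q_mat H $$ (i, j) * x $ j))" for i j
  note t = selector_vec_carrier[of n M k]
  note G = G_tilde_carrier[OF H, of M]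
  have Q: "Q_mat H \<in> carrier_mat n n"
    unfolding Q_mat_def using mat_adjoint_carrier[OF H] H by simp
  have xc: "x \<in> carrier_vec n" by (simp add: x)
  have c: "c_vec H r \<in> carrier_vec n"
    unfolding c_vec_def using mult_mat_vec_carrier[OF mat_adjoint_carrier[OF H] r] by simp
  have div: "(i * M + k i) div M = i" "(i * M + k i) mod M = k i" if "i < n" for i
    using k[OF that] by auto
  have lt: "i * M + k i < n * M" if "i < n" for i using block_index_less k that by blast
  have entry: "G_tilde n M H $$ (i * M + k i, j * M + k j) = (if i = j then 0 else q i j)"
    if "i < n" "j < n" for i j
    using that k by (simp add: G_tilde_index[OF H lt lt] G_mat_index[OF H lt lt] div q_def x
        del: times_complex.sel complex_cnj_mult mod_mult_self3)
  have "?t \<bullet> (G_tilde n M H *\<^sub>v ?t) = (\<Sum>a<n * M. ?t $ a * (G_tilde n M H *\<^sub>v ?t) $ a)"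
    using t G by (simp add: scalar_prod_def atLeast0LessThan)
  also have "\<dots> = (\<Sum>i<n. (G_tilde n M H *\<^sub>v ?t) $ (i * M + k i))"
    by (rule sum_selector_vec[OF k])
  also have "\<dots> = (\<Sum>i<n. \<Sum>j<n. if i = j then 0 else q i j)"
  proof (rule sum.cong[OF refl])
    fix i assume "i \<in> {..<n}"
    then have i: "i < n" by simp
    have "(G_tilde n M H *\<^sub>v ?t) $ (i * M + k i)
        = (\<Sum>b<n * M. ?t $ b * G_tilde n M H $$ (i * M + k i, b))"
      using t G lt[OF i] by (simp add: scalar_prod_def atLeast0LessThan mult.commute)
    also have "\<dots> = (\<Sum>j<n. G_tilde n M H $$ (i * M + k i, j * M + k j))"
      by (rule sum_selector_vec[OF k])
    also have "\<dots> = (\<Sum>j<n. if i = j then 0 else q i j)" by (simp add: entry i)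
    finally show "(G_tilde n M H *\<^sub>v ?t) $ (i * M + k i) = (\<Sum>j<n. if i = j then 0 else q i j)" .
  qed
  \<comment> \<open>Putting the diagonal terms back and subtracting them again exposes the full
    Hermitian form.\<close>
  also have "\<dots> = (\<Sum>i<n. (\<Sum>j<n. q i j) - q i i)"
  proof (rule sum.cong[OF refl])
    fix i assume "i \<in> {..<n}"
    then show "(\<Sum>j<n. if i = j then 0 else q i j) = (\<Sum>j<n. q i j) - q i i"
      by (simp add: sum.remove[of "{..<n}" i])
  qed
  also have "\<dots> = (\<Sum>i<n. \<Sum>j<n. q i j) - (\<Sum>i<n. Re (Q_mat H $$ (i, i)))"
  proof -
    have "q i i = Re (Q_mat H $$ (i, i))" if "i < n" for i
    proof -
      have "x $ i * cnj (x $ i) = 1"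
        using that by (simp add: x psk_point_eq_cis cis_cnj cis_mult)
      then have "x $ i * cnj (Q_mat H $$ (i, i) * x $ i) = cnj (Q_mat H $$ (i, i))"
        by (metis complex_cnj_mult mult.left_commute mult.right_neutral)
      then show ?thesis unfolding q_def by (simp only: cnj.sel)
    qed
    then show ?thesis by (simp add: sum_subtractf)
  qed
  also have "(\<Sum>i<n. \<Sum>j<n. q i j) = re_inner x (Q_mat H *\<^sub>v x)"
  proof -
    have "re_inner x (Q_mat H *\<^sub>v x) = (\<Sum>i<n. Re (x $ i * cnj ((Q_mat H *\<^sub>v x) $ i)))"
      by (rule re_inner_eq_sum) (use xc Q in auto)
    also have "\<dots> = (\<Sum>i<n. \<Sum>j<n. q i j)"
      by (intro sum.cong refl) (simp add: index_mult_mat_vec_sum[OF Q xc] q_def sum_distrib_left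
          del: index_mult_mat_vec times_complex.sel complex_cnj_mult)
    finally show ?thesis ..
  qed
  finally have quad: "?t \<bullet> (G_tilde n M H *\<^sub>v ?t) =
    re_inner x (Q_mat H *\<^sub>v x) - (\<Sum>i<n. Re (Q_mat H $$ (i, i)))" .
  have "w_vec n M H r \<bullet> ?t = (\<Sum>a<n * M. ?t $ a * w_vec n M H r $ a)"
    using t by (simp add: scalar_prod_def atLeast0LessThan mult.commute)
  also have "\<dots> = (\<Sum>i<n. w_vec n M H r $ (i * M + k i))" by (rule sum_selector_vec[OF k])
  also have "\<dots> = re_inner x (c_vec H r)"
    unfolding re_inner_eq_sum[OF xc c]
    by (intro sum.cong refl) (simp add: w_vec_index[OF H r lt] div k x)
  finally show ?thesis unfolding sqp2_objective_def quad by simp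
qed

section \<open>Optimality gap\<close>

lemma linf_norm_ge: "i < dim_vec u \<Longrightarrow> cmod (u $ i) \<le> linf_norm u"
proof -
  assume i: "i < dim_vec u"
  have "{cmod (u $ i) | i. i < dim_vec u} = (\<lambda>i. cmod (u $ i)) ` {..<dim_vec u}" by auto
  then show ?thesis unfolding linf_norm_def using i by (intro Max_ge) auto
qed

text \<open>The diagonal constant is the same for both points and cancels, so the comparison is
  between two least-squares values.\<close>

lemma sqp2_objective_gap:
  assumes H: "H \<in> carrier_mat m n" and v: "v \<in> carrier_vec m" and "n \<ge> 1" "M \<ge> 2"
    and k: "\<And>j. j < n \<Longrightarrow> k j < M" and l: "\<And>j. j < n \<Longrightarrow> l j < M"
    and r: "r = H *\<^sub>v vec n (\<lambda>j. psk_point M (l j + 1)) + v"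
    and gap: "lambda_min (mat_adjoint H * H) * sin (pi / real M) > linf_norm (mat_adjoint H *\<^sub>v v)"
    and ne: "selector_vec n M k \<noteq> selector_vec n M l"
  shows "sqp2_objective n M H r (selector_vec n M l) < sqp2_objective n M H r (selector_vec n M k)"
proof -
  define x where "x = vec n (\<lambda>j. psk_point M (k j + 1))"
  define y where "y = vec n (\<lambda>j. psk_point M (l j + 1))"
  define d where "d = x - y"
  define u where "u = mat_adjoint H *\<^sub>v v"
  define s where "s = sin (pi / real M)"
  define \<Lambda> where "\<Lambda> = lambda_min (mat_adjoint H * H)"
  define L where "L = linf_norm u"
  define Q where "Q = mat_adjoint H * H"
  have x: "x \<in> carrier_vec n" and y: "y \<in> carrier_vec n" and d: "d \<in> carrier_vec n"
    by (auto simp: x_def y_def d_def)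
  have rc: "r \<in> carrier_vec m" using H v by (simp add: r)
  have Ha: "mat_adjoint H \<in> carrier_mat n m" by (rule mat_adjoint_carrier[OF H])
  have Q: "Q \<in> carrier_mat n n" unfolding Q_def using Ha H by simp
  have u: "u \<in> carrier_vec n" unfolding u_def using Ha v by simp
  have Hx: "H *\<^sub>v z \<in> carrier_vec m" if "z \<in> carrier_vec n" for z using H that by simp
  have adj: "re_inner z (mat_adjoint H *\<^sub>v b) = re_inner (H *\<^sub>v z) b"
    if "z \<in> carrier_vec n" "b \<in> carrier_vec m" for z b
    using re_inner_adjoint[OF H that(2,1)] Ha H that
    by (simp add: re_inner_comm[of z n] re_inner_comm[of "H *\<^sub>v z" m])
  have Qz: "re_inner z (Q *\<^sub>v w) = re_inner (H *\<^sub>v z) (H *\<^sub>v w)"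
    if "z \<in> carrier_vec n" "w \<in> carrier_vec n" for z w
    unfolding Q_def using adj[OF that(1) Hx[OF that(2)]] Ha H that by simp
  have sym: "re_inner (Q *\<^sub>v z) w = re_inner z (Q *\<^sub>v w)"
    if "z \<in> carrier_vec n" "w \<in> carrier_vec n" for z w
    using Qz[OF that] Qz[OF that(2,1)] re_inner_comm[OF Hx[OF that(1)] Hx[OF that(2)]]
      re_inner_comm[of "Q *\<^sub>v z" n w] Q that by simp
  \<comment> \<open>The right-hand side is the squared norm of \<open>H z - r\<close> minus that of
    \<open>r\<close>.\<close>
  have form: "re_inner z (Q_mat H *\<^sub>v z) + 2 * re_inner z (c_vec H r)
      = re_inner (H *\<^sub>v z) (H *\<^sub>v z) - 2 * re_inner (H *\<^sub>v z) r" if z: "z \<in> carrier_vec n" for z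
  proof -
    have w: "mat_adjoint H *\<^sub>v r \<in> carrier_vec n" using Ha rc by simp
    have "re_inner z (c_vec H r) = - re_inner z (mat_adjoint H *\<^sub>v r)"
      unfolding c_vec_def using re_inner_uminus_left[OF w z] w z
      by (simp add: re_inner_comm[OF z])
    then show ?thesis using Qz[OF z z] adj[OF z rc] by (simp add: Q_mat_def Q_def)
  qed
  define a where "a = H *\<^sub>v y"
  define e where "e = H *\<^sub>v d"
  have a: "a \<in> carrier_vec m" and e: "e \<in> carrier_vec m"
    using Hx[OF y] Hx[OF d] by (simp_all add: a_def e_def)
  have "x = y + d" using x y by (intro eq_vecI) (auto simp: d_def)
  then have Hx_split: "H *\<^sub>v x = a + e"
    unfolding a_def e_def using mult_add_distrib_mat_vec[OF H y d] by simp
  have r': "r = a + v" by (simp add: r a_def y_def)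
  have obj_k: "sqp2_objective n M H r (selector_vec n M k) = re_inner x (Q_mat H *\<^sub>v x)
      + 2 * re_inner x (c_vec H r) - (\<Sum>i<n. Re (Q_mat H $$ (i, i)))"
    by (rule sqp2_objective_selector[OF H rc k x_def])
  have obj_l: "sqp2_objective n M H r (selector_vec n M l) = re_inner y (Q_mat H *\<^sub>v y)
      + 2 * re_inner y (c_vec H r) - (\<Sum>i<n. Re (Q_mat H $$ (i, i)))"
    by (rule sqp2_objective_selector[OF H rc l y_def])
  have "sqp2_objective n M H r (selector_vec n M k) - sqp2_objective n M H r (selector_vec n M l)
      = re_inner (H *\<^sub>v x) (H *\<^sub>v x) - 2 * re_inner (H *\<^sub>v x) r
        - (re_inner (H *\<^sub>v y) (H *\<^sub>v y) - 2 * re_inner (H *\<^sub>v y) r)"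
    unfolding obj_k obj_l using form[OF x] form[OF y] by simp
  \<comment> \<open>With \<open>H x = a + e\<close> and \<open>r = a + v\<close>, the cross terms
    between \<open>a\<close> and \<open>e\<close> cancel by symmetry.\<close>
  also have "\<dots> = re_inner e e - 2 * re_inner e v"
    unfolding Hx_split a_def[symmetric] r' using a e v re_inner_comm[OF a e]
    by (simp add: re_inner_add_left[of _ m] re_inner_add_right[of _ m])
  also have "\<dots> = re_inner (Q *\<^sub>v d) d - 2 * re_inner d u"
    using Qz[OF d d] sym[OF d d] adj[OF d v] by (simp add: e_def u_def)
  finally have diff: "sqp2_objective n M H r (selector_vec n M k)
    - sqp2_objective n M H r (selector_vec n M l) = re_inner (Q *\<^sub>v d) d - 2 * re_inner d u" .
  define D where "D = (\<Sum>i<n. cmod (d $ i))"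
  have L_ge: "cmod (u $ i) \<le> L" if "i < n" for i
    unfolding L_def using u that by (intro linf_norm_ge) simp
  \<comment> \<open>Coordinate 0 exists because \<open>n \<ge> 1\<close>. Together with the gap
    hypothesis this forces \<open>\<Lambda> > 0\<close>, so inequalities may be multiplied by
    \<open>\<Lambda>\<close>.\<close>
  have "L \<ge> 0" using L_ge[of 0] \<open>n \<ge> 1\<close> norm_ge_zero[of "u $ 0"] by linarith
  have s_pos: "s > 0" unfolding s_def by (rule sin_pi_over_pos[OF \<open>M \<ge> 2\<close>])
  have gap': "L < \<Lambda> * s" using gap by (simp add: L_def \<Lambda>_def s_def u_def)
  then have \<Lambda>_pos: "\<Lambda> > 0" using \<open>L \<ge> 0\<close> s_pos by (metis le_less_trans zero_less_mult_pos2)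
  \<comment> \<open>Hoelder's inequality for the l1 and sup norms, where \<open>D\<close> is the l1
    norm of \<open>d\<close>.\<close>
  have "re_inner d u \<le> (\<Sum>i<n. L * cmod (d $ i))"
    unfolding re_inner_eq_sum[OF d u]
  proof (rule sum_mono)
    fix i assume "i \<in> {..<n}"
    have "Re (d $ i * cnj (u $ i)) \<le> cmod (d $ i) * cmod (u $ i)"
      by (metis complex_Re_le_cmod complex_mod_cnj norm_mult)
    also have "\<dots> \<le> L * cmod (d $ i)"
      using mult_right_mono[OF L_ge[of i] norm_ge_zero[of "d $ i"]] \<open>i \<in> {..<n}\<close>
      by (simp add: mult.commute)
    finally show "Re (d $ i * cnj (u $ i)) \<le> L * cmod (d $ i)" .
  qed
  then have up: "re_inner d u \<le> L * D" by (simp add: D_def sum_distrib_left)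
  have d_i: "d $ i = psk_point M (k i + 1) - psk_point M (l i + 1)" if "i < n" for i
    using that by (simp add: d_def x_def y_def)
  \<comment> \<open>A coordinate of \<open>d\<close> is either 0 or at least \<open>2 * s\<close> in
    modulus. Hence the squared norm of \<open>d\<close> dominates \<open>2 * s * D\<close>, which
    matches the l1 bound on the noise term.\<close>
  have "2 * s * cmod (d $ i) \<le> (cmod (d $ i))\<^sup>2" if "i < n" for i
  proof (cases "k i = l i")
    case True
    then show ?thesis using d_i[OF that] by simp
  next
    case False
    then have "2 * s \<le> cmod (d $ i)"
      unfolding d_i[OF that] s_def using k[OF that] l[OF that] by (intro psk_point_separation)
    then show ?thesis unfolding power2_eq_square by (rule mult_right_mono) simp
  qed
  then have "2 * s * D \<le> re_inner d d"
    unfolding D_def sum_distrib_left re_inner_self[OF d] by (intro sum_mono) simp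
  then have "\<Lambda> * (2 * s * D) \<le> \<Lambda> * re_inner d d" using \<Lambda>_pos by (intro mult_left_mono) auto
  also have "\<dots> \<le> re_inner (Q *\<^sub>v d) d"
    unfolding \<Lambda>_def Q_def[symmetric] by (rule lambda_min_rayleigh[OF Q sym d])
  finally have low: "\<Lambda> * (2 * s * D) \<le> re_inner (Q *\<^sub>v d) d" .
  \<comment> \<open>Different selector vectors differ in some index below \<open>n\<close>, and
    injectivity of the constellation makes that coordinate of \<open>d\<close> nonzero.\<close>
  have "D > 0"
  proof -
    obtain i where i: "i < n" "k i \<noteq> l i"
    proof (rule ccontr)
      assume "\<not> thesis"
      then have "k i = l i" if "i < n" for i using that \<open>\<And>i. i < n \<Longrightarrow> k i \<noteq> l i \<Longrightarrow> thesis\<close> by blast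
      then have "selector_vec n M k = selector_vec n M l"
        by (intro eq_vecI) (auto simp: selector_vec_def less_mult_imp_div_less)
      then show False using ne by simp
    qed
    have "d $ i \<noteq> 0" using psk_point_inj[OF \<open>M \<ge> 2\<close> k[OF i(1)] l[OF i(1)]] i by (auto simp: d_i)
    then show ?thesis unfolding D_def using i by (intro sum_pos2[of _ i]) auto
  qed
  then have "L * D < \<Lambda> * s * D" using gap' by simp
  then have "0 < re_inner (Q *\<^sub>v d) d - 2 * re_inner d u" using low up by (simp add: algebra_simps)
  then show ?thesis using diff by simp
qed

theorem theorem3p7:
  fixes m n M :: nat
    and H :: "complex Matrix.mat"
    and x_star v r :: "complex Matrix.vec"
    and t_star :: "real Matrix.vec"
  assumes "m \<ge> 1" and "n \<ge> 1" and "M \<ge> 2"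
    and "H \<in> carrier_mat m n"
    and "x_star \<in> psk_vecs n M"
    and "v \<in> carrier_vec m"
    and "r = H *\<^sub>v x_star + v"
    and "t_star = assignment_vec n M x_star"
    and "lambda_min (mat_adjoint H * H) * sin (pi / real M) > linf_norm (mat_adjoint H *\<^sub>v v)"
  shows "is_arg_min (sqp2_objective n M H r) (sqp2_feasible n M) t_star \<and>
         (\<forall>t. is_arg_min (sqp2_objective n M H r) (sqp2_feasible n M) t \<longrightarrow> t = t_star)"
proof -
  have xs: "x_star \<in> carrier_vec n" using assms(5) by (simp add: psk_vecs_def)
  have "\<exists>a<M. x_star $ j = psk_point M (a + 1)" if "j < n" for j
  proof -
    have "x_star $ j \<in> psk_point M ` {1..M}"
      using assms(5) that by (simp add: psk_vecs_def psk_def)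
    then obtain b where "b \<in> {1..M}" "x_star $ j = psk_point M b" by blast
    \<comment> \<open>Phases are numbered from 1 and block entries from 0.\<close>
    then show ?thesis by (intro exI[of _ "b - 1"]) auto
  qed
  then obtain l where l: "l j < M" "x_star $ j = psk_point M (l j + 1)" if "j < n" for j
    by metis
  have t_star: "t_star = selector_vec n M l"
    unfolding assms(8) by (rule assignment_vec_eq_selector[OF assms(3) l(1) xs l(2)])
  have "x_star = vec n (\<lambda>j. psk_point M (l j + 1))" using xs l(2) by (intro eq_vecI) auto
  with assms(7) have r: "r = H *\<^sub>v vec n (\<lambda>j. psk_point M (l j + 1)) + v" by simp
  have feas: "sqp2_feasible n M t_star"
    unfolding t_star by (rule sqp2_feasible_selector[OF l(1)])
  \<comment> \<open>A strict inequality against every other feasible point gives both minimality and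
    uniqueness.\<close>
  have less: "sqp2_objective n M H r t_star < sqp2_objective n M H r t"
    if t_feas: "sqp2_feasible n M t" and t_ne: "t \<noteq> t_star" for t
  proof -
    obtain k where k: "\<And>j. j < n \<Longrightarrow> k j < M" and t: "t = selector_vec n M k"
      using sqp2_feasible_imp_selector[OF t_feas] by blast
    show ?thesis unfolding t t_star
      by (rule sqp2_objective_gap[OF assms(4,6,2,3) k l(1) r assms(9)])
        (use t_ne in \<open>simp_all add: t t_star\<close>)
  qed
  show ?thesis unfolding is_arg_min_def using feas less by (metis less_asym)
qed

end
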